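(* Let $M$ be a separable complete metric space (with a distinguished base point). If $B_{\mathcal F(M)}$ is the closed convex hull of its denting points, then $\operatorname{bc}(\operatorname{Lip}_0(M))=1$.
   Context: Let $(M,d)$ be a complete metric space with a distinguished point $0\in M$. $\operatorname{Lip}_0(M)$ is the real Banach space of all Lipschitz functions $f:M\to\mathbb R$ with $f(0)=0$, with norm $\|f\|=\sup\{|f(x)-f(y)|/d(x,y):x\ne y\in M\}$. For $x\in M$ let $\delta(x)\in\operatorname{Lip}_0(M)^*$ be the evaluation $f\mapsto f(x)$. The Lipschitz-free space is $\mathcal F(M):=\overline{\operatorname{span}}\{\delta(x):x\in M\}\subset\operatorname{Lip}_0(M)^*$; $B_{\mathcal F(M)}$ is its closed unit ball. One has $\mathcal F(M)^*=\operatorname{Lip}_0(M)$ isometrically. A slice of a bounded convex set $C$ is a non-empty intersection of $C$ with an open half-space. A point $x$ of a bounded closed convex set $C$ is a denting point of $C$ if for every $\varepsilon>0$ there is a slice $S$ of $C$ with $x\in S$ and $\operatorname{diam}(S)<\varepsilon$. For $\alpha\in[-1,1)$, a Banach space $Z$ with unit sphere $S_Z$ has the $\alpha$-BCP if there is a countable collection of open balls $\{B(z_n,r_n)\}$ (center $z_n$, radius $r_n>0$) with $S_Z\subset\bigcup_n B(z_n,r_n)$ and $\|z_n\|\ge r_n+\alpha$ for all $n$. The ball-covering index is $\operatorname{bc}(Z):=\sup\{\alpha\in[-1,1): Z\text{ has the }\alpha\text{-BCP}\}$ ($=-1$ if this set is empty). *)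

theory Defs
  imports "HOL-Analysis.Analysis"
begin

section \<open>The space of Lipschitz functions vanishing at the base point\<close>

text \<open>
  A pointed metric space is a type of class \<open>metric_space\<close> and of the purely syntactic class
  \<open>zero\<close>, whose constant \<open>0\<close> is the distinguished point (no algebraic structure is assumed).
\<close>

typedef (overloaded) 'a lip0 = "{f :: 'a::{metric_space,zero} \<Rightarrow> real. f 0 = 0 \<and> (\<exists>C. C-lipschitz_on UNIV f)}"
  morphisms lip0_apply Abs_lip0
  by (rule exI[of _ "\<lambda>_. 0"]) (auto intro!: exI[of _ 0] lipschitz_onI)

setup_lifting type_definition_lip0

instantiation lip0 :: ("{metric_space,zero}") real_vector
begin

lift_definition zero_lip0 :: "'a lip0" is "\<lambda>_. 0"
  by (auto intro!: exI[of _ 0] lipschitz_onI)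

lift_definition plus_lip0 :: "'a lip0 \<Rightarrow> 'a lip0 \<Rightarrow> 'a lip0" is "\<lambda>f g x. f x + g x"
  by (auto intro: lipschitz_on_add)

lift_definition uminus_lip0 :: "'a lip0 \<Rightarrow> 'a lip0" is "\<lambda>f x. - f x"
  by (auto intro: lipschitz_on_minus)

lift_definition minus_lip0 :: "'a lip0 \<Rightarrow> 'a lip0 \<Rightarrow> 'a lip0" is "\<lambda>f g x. f x - g x"
  by (auto intro: lipschitz_on_diff)

lift_definition scaleR_lip0 :: "real \<Rightarrow> 'a lip0 \<Rightarrow> 'a lip0" is "\<lambda>c f x. c * f x"
  by (auto intro: lipschitz_on_cmult_real)

instance
  by standard (transfer; auto simp: algebra_simps fun_eq_iff)+

end

lemma lip0_apply_0 [simp]: "lip0_apply f 0 = 0"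
  by transfer auto

lemma lip0_lipschitz: "\<exists>C. C-lipschitz_on UNIV (lip0_apply f)"
  by transfer auto

text \<open>Adding \<open>0\<close> to the set of slopes only matters when \<open>M\<close> is a singleton (empty supremum).\<close>

definition slopes :: "('a::metric_space \<Rightarrow> real) \<Rightarrow> real set" where
  "slopes f = insert 0 {\<bar>f x - f y\<bar> / dist x y | x y. x \<noteq> y}"

lemma slopes_le:
  assumes "C-lipschitz_on UNIV f" "s \<in> slopes f" shows "s \<le> C"
  using assms lipschitz_on_nonneg[OF assms(1)]
  by (auto simp: slopes_def lipschitz_on_def dist_real_def pos_divide_le_eq)

lemma bdd_above_slopes: "bdd_above (slopes (lip0_apply f))"
  using lip0_lipschitz[of f] slopes_le unfolding bdd_above_def by blast

instantiation lip0 :: ("{metric_space,zero}") real_normed_vector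
begin

definition norm_lip0 :: "'a lip0 \<Rightarrow> real" where
  "norm_lip0 f = Sup (slopes (lip0_apply f))"

definition sgn_lip0 :: "'a lip0 \<Rightarrow> 'a lip0" where
  "sgn_lip0 f = f /\<^sub>R norm f"

definition dist_lip0 :: "'a lip0 \<Rightarrow> 'a lip0 \<Rightarrow> real" where
  "dist_lip0 f g = norm (f - g)"

definition uniformity_lip0 :: "('a lip0 \<times> 'a lip0) filter" where
  "uniformity_lip0 = (INF e\<in>{0<..}. principal {(x, y). dist x y < e})"

definition open_lip0 :: "'a lip0 set \<Rightarrow> bool" where
  "open_lip0 U \<longleftrightarrow> (\<forall>x\<in>U. eventually (\<lambda>(x', y). x' = x \<longrightarrow> y \<in> U) uniformity)"

lemma norm_lip0_nonneg: "0 \<le> norm (f :: 'a lip0)"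
  unfolding norm_lip0_def by (rule cSup_upper[OF _ bdd_above_slopes]) (simp add: slopes_def)

lemma lip0_norm_lipschitz: "\<bar>lip0_apply f x - lip0_apply f y\<bar> \<le> norm f * dist x y"
proof (cases "x = y")
  case False
  have "\<bar>lip0_apply f x - lip0_apply f y\<bar> / dist x y \<le> norm f"
    unfolding norm_lip0_def
    by (rule cSup_upper[OF _ bdd_above_slopes]) (use False in \<open>auto simp: slopes_def\<close>)
  then show ?thesis using False by (simp add: divide_simps)
qed simp

lemma norm_lip0_le:
  assumes "0 \<le> C" "\<And>x y. \<bar>lip0_apply f x - lip0_apply f y\<bar> \<le> C * dist x y"
  shows "norm (f :: 'a lip0) \<le> C"
  unfolding norm_lip0_def
  by (rule cSup_least) (use assms in \<open>auto simp: slopes_def pos_divide_le_eq\<close>)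

lemma lip0_apply_bound: "\<bar>lip0_apply f x\<bar> \<le> norm f * dist x 0"
  using lip0_norm_lipschitz[of f x 0] by simp

lemma norm_lip0_scaleR_le: "norm (a *\<^sub>R f) \<le> \<bar>a\<bar> * norm (f :: 'a lip0)"
proof (rule norm_lip0_le)
  fix x y
  have "\<bar>lip0_apply (a *\<^sub>R f) x - lip0_apply (a *\<^sub>R f) y\<bar> = \<bar>a\<bar> * \<bar>lip0_apply f x - lip0_apply f y\<bar>"
    by (simp add: scaleR_lip0.rep_eq abs_mult flip: right_diff_distrib)
  also have "\<dots> \<le> \<bar>a\<bar> * (norm f * dist x y)"
    by (intro mult_left_mono lip0_norm_lipschitz) simp
  finally show "\<bar>lip0_apply (a *\<^sub>R f) x - lip0_apply (a *\<^sub>R f) y\<bar> \<le> \<bar>a\<bar> * norm f * dist x y"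
    by (simp add: mult.assoc)
qed (simp add: norm_lip0_nonneg)

instance
proof
  fix f g :: "'a lip0" and a :: real
  show "norm f = 0 \<longleftrightarrow> f = 0"
  proof
    assume "norm f = 0"
    then have "lip0_apply f x = 0" for x using lip0_apply_bound[of f x] by simp
    then show "f = 0" by transfer auto
  next
    assume "f = 0"
    then have "norm f \<le> 0" by (intro norm_lip0_le) (auto simp: zero_lip0.rep_eq)
    then show "norm f = 0" using norm_lip0_nonneg[of f] by simp
  qed
  show "norm (f + g) \<le> norm f + norm g"
  proof (rule norm_lip0_le)
    fix x y
    show "\<bar>lip0_apply (f + g) x - lip0_apply (f + g) y\<bar> \<le> (norm f + norm g) * dist x y"
      using lip0_norm_lipschitz[of f x y] lip0_norm_lipschitz[of g x y]
      by (simp add: plus_lip0.rep_eq distrib_right)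
  qed (simp add: norm_lip0_nonneg)
  show "norm (a *\<^sub>R f) = \<bar>a\<bar> * norm f"
  proof (cases "a = 0")
    case True
    then show ?thesis using norm_lip0_scaleR_le[of a f] norm_lip0_nonneg[of "a *\<^sub>R f"] by simp
  next
    case False
    have "norm f \<le> \<bar>inverse a\<bar> * norm (a *\<^sub>R f)"
      using norm_lip0_scaleR_le[of "inverse a" "a *\<^sub>R f"] False by simp
    then have "\<bar>a\<bar> * norm f \<le> norm (a *\<^sub>R f)"
      using False by (simp add: field_simps)
    then show ?thesis using norm_lip0_scaleR_le[of a f] by simp
  qed
qed (rule sgn_lip0_def dist_lip0_def uniformity_lip0_def open_lip0_def)+

end

instance lip0 :: ("{metric_space,zero}") banach
proof
  fix X :: "nat \<Rightarrow> 'a lip0"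
  assume X: "Cauchy X"
  have bd: "\<bar>lip0_apply (X m) x - lip0_apply (X n) x - (lip0_apply (X m) y - lip0_apply (X n) y)\<bar>
      \<le> norm (X m - X n) * dist x y" for m n x y
    using lip0_norm_lipschitz[of "X m - X n" x y] by (simp add: minus_lip0.rep_eq)
  have "convergent (\<lambda>n. lip0_apply (X n) x)" for x
  proof (rule Cauchy_convergent, rule metric_CauchyI)
    fix e :: real assume e: "e > 0"
    have "e / (dist x 0 + 1) > 0" using e by (simp add: add_nonneg_pos)
    then obtain N where N: "\<And>m n. m \<ge> N \<Longrightarrow> n \<ge> N \<Longrightarrow> norm (X m - X n) < e / (dist x 0 + 1)"
      using CauchyD[OF X] by meson
    show "\<exists>M. \<forall>m\<ge>M. \<forall>n\<ge>M. dist (lip0_apply (X m) x) (lip0_apply (X n) x) < e"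
    proof (intro exI allI impI)
      fix m n assume "N \<le> m" "N \<le> n"
      then have "norm (X m - X n) < e / (dist x 0 + 1)" by (rule N)
      then have "norm (X m - X n) * (dist x 0 + 1) < e"
        using e by (simp add: pos_less_divide_eq add_nonneg_pos)
      moreover have "norm (X m - X n) * dist x 0 \<le> norm (X m - X n) * (dist x 0 + 1)"
        by (intro mult_left_mono) auto
      ultimately show "dist (lip0_apply (X m) x) (lip0_apply (X n) x) < e"
        using bd[of m x n 0] by (simp add: dist_real_def)
    qed
  qed
  then obtain g where g: "\<And>x. (\<lambda>n. lip0_apply (X n) x) \<longlonglongrightarrow> g x"
    unfolding convergent_def by metis
  have lim: "\<bar>lip0_apply (X m) x - g x - (lip0_apply (X m) y - g y)\<bar> \<le> e * dist x y"
    if "\<And>n. n \<ge> N \<Longrightarrow> norm (X m - X n) \<le> e" for m N e x y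
  proof (rule tendsto_upperbound)
    show "(\<lambda>n. \<bar>lip0_apply (X m) x - lip0_apply (X n) x - (lip0_apply (X m) y - lip0_apply (X n) y)\<bar>)
        \<longlonglongrightarrow> \<bar>lip0_apply (X m) x - g x - (lip0_apply (X m) y - g y)\<bar>"
      by (intro tendsto_intros g)
    show "\<forall>\<^sub>F n in sequentially. \<bar>lip0_apply (X m) x - lip0_apply (X n) x
        - (lip0_apply (X m) y - lip0_apply (X n) y)\<bar> \<le> e * dist x y"
      unfolding eventually_sequentially
      by (meson bd order_trans mult_right_mono that zero_le_dist)
  qed simp
  have ev: "\<exists>N. \<forall>m\<ge>N. \<forall>n\<ge>N. norm (X m - X n) \<le> e" if "e > 0" for e
    using CauchyD[OF X that] less_imp_le by blast
  obtain N1 where N1: "\<And>m n. m \<ge> N1 \<Longrightarrow> n \<ge> N1 \<Longrightarrow> norm (X m - X n) \<le> 1"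
    using ev[of 1] by auto
  have "(norm (X N1) + 1)-lipschitz_on UNIV g"
  proof (rule lipschitz_onI)
    fix x y
    show "dist (g x) (g y) \<le> (norm (X N1) + 1) * dist x y"
      using lim[of N1 N1 1 x y] N1[of N1] lip0_norm_lipschitz[of "X N1" x y]
      by (auto simp: dist_real_def distrib_right)
  qed simp
  moreover have "g 0 = 0"
    using g[of 0] LIMSEQ_unique tendsto_const by (auto simp: LIMSEQ_const_iff)
  ultimately have app: "lip0_apply (Abs_lip0 g) = g"
    by (auto intro!: Abs_lip0_inverse)
  have "X \<longlonglongrightarrow> Abs_lip0 g"
  proof (rule LIMSEQ_I)
    fix r :: real assume "r > 0"
    then obtain N where N: "\<And>m n. m \<ge> N \<Longrightarrow> n \<ge> N \<Longrightarrow> norm (X m - X n) \<le> r / 2"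
      using ev[of "r/2"] by auto
    have "norm (X m - Abs_lip0 g) \<le> r / 2" if "m \<ge> N" for m
      using lim[of N m "r/2"] N that \<open>r > 0\<close>
      by (intro norm_lip0_le) (auto simp: minus_lip0.rep_eq app)
    then have "norm (X m - Abs_lip0 g) < r" if "m \<ge> N" for m
      using that \<open>r > 0\<close> by fastforce
    then show "\<exists>no. \<forall>n\<ge>no. norm (X n - Abs_lip0 g) < r" by blast
  qed
  then show "convergent X" unfolding convergent_def by blast
qed


section \<open>The Lipschitz-free space\<close>

lift_definition lip_eval :: "'a::{metric_space,zero} \<Rightarrow> 'a lip0 \<Rightarrow>\<^sub>L real" is "\<lambda>x f. lip0_apply f x"
proof (rule bounded_linear_intro)
  show "norm (lip0_apply f x) \<le> norm f * dist x 0" for x :: 'a and f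
    using lip0_apply_bound by simp
qed (auto simp: plus_lip0.rep_eq scaleR_lip0.rep_eq)

definition lip_free_set :: "('a::{metric_space,zero} lip0 \<Rightarrow>\<^sub>L real) set" where
  "lip_free_set = closure (span (range lip_eval))"

lemma subspace_lip_free_set: "subspace (lip_free_set :: ('a::{metric_space,zero} lip0 \<Rightarrow>\<^sub>L real) set)"
  unfolding subspace_def
proof (intro conjI ballI allI)
  show "0 \<in> (lip_free_set :: ('a lip0 \<Rightarrow>\<^sub>L real) set)"
    unfolding lip_free_set_def using closure_subset span_zero by blast
next
  fix m n :: "'a lip0 \<Rightarrow>\<^sub>L real"
  assume "m \<in> lip_free_set" "n \<in> lip_free_set"
  then obtain X Y where "\<And>i. X i \<in> span (range lip_eval)" "X \<longlonglongrightarrow> m"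
      "\<And>i. Y i \<in> span (range lip_eval)" "Y \<longlonglongrightarrow> n"
    unfolding lip_free_set_def closure_sequential by metis
  then show "m + n \<in> lip_free_set"
    unfolding lip_free_set_def closure_sequential
    by (intro exI[of _ "\<lambda>i. X i + Y i"]) (auto intro: span_add tendsto_add)
next
  fix c :: real and m :: "'a lip0 \<Rightarrow>\<^sub>L real"
  assume "m \<in> lip_free_set"
  then obtain X where "\<And>i. X i \<in> span (range lip_eval)" "X \<longlonglongrightarrow> m"
    unfolding lip_free_set_def closure_sequential by metis
  then show "c *\<^sub>R m \<in> lip_free_set"
    unfolding lip_free_set_def closure_sequential
    by (intro exI[of _ "\<lambda>i. c *\<^sub>R X i"]) (auto intro: span_scale tendsto_scaleR)
qed

typedef (overloaded) 'a lip_free = "lip_free_set :: ('a::{metric_space,zero} lip0 \<Rightarrow>\<^sub>L real) set"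
  using subspace_0[OF subspace_lip_free_set] by blast

setup_lifting type_definition_lip_free

instantiation lip_free :: ("{metric_space,zero}") real_vector
begin

lift_definition zero_lip_free :: "'a lip_free" is 0
  by (rule subspace_0[OF subspace_lip_free_set])

lift_definition plus_lip_free :: "'a lip_free \<Rightarrow> 'a lip_free \<Rightarrow> 'a lip_free" is "(+)"
  by (rule subspace_add[OF subspace_lip_free_set])

lift_definition uminus_lip_free :: "'a lip_free \<Rightarrow> 'a lip_free" is uminus
  by (rule subspace_neg[OF subspace_lip_free_set])

lift_definition minus_lip_free :: "'a lip_free \<Rightarrow> 'a lip_free \<Rightarrow> 'a lip_free" is "(-)"
  by (rule subspace_diff[OF subspace_lip_free_set])

lift_definition scaleR_lip_free :: "real \<Rightarrow> 'a lip_free \<Rightarrow> 'a lip_free" is scaleR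
  by (rule subspace_scale[OF subspace_lip_free_set])

instance
  by standard (transfer; simp add: algebra_simps)+

end

instantiation lip_free :: ("{metric_space,zero}") real_normed_vector
begin

lift_definition norm_lip_free :: "'a lip_free \<Rightarrow> real" is norm .

definition sgn_lip_free :: "'a lip_free \<Rightarrow> 'a lip_free" where
  "sgn_lip_free m = m /\<^sub>R norm m"

definition dist_lip_free :: "'a lip_free \<Rightarrow> 'a lip_free \<Rightarrow> real" where
  "dist_lip_free m n = norm (m - n)"

definition uniformity_lip_free :: "('a lip_free \<times> 'a lip_free) filter" where
  "uniformity_lip_free = (INF e\<in>{0<..}. principal {(x, y). dist x y < e})"

definition open_lip_free :: "'a lip_free set \<Rightarrow> bool" where
  "open_lip_free U \<longleftrightarrow> (\<forall>x\<in>U. eventually (\<lambda>(x', y). x' = x \<longrightarrow> y \<in> U) uniformity)"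

instance
proof
  fix m n :: "'a lip_free" and a :: real
  show "norm m = 0 \<longleftrightarrow> m = 0" by transfer simp
  show "norm (m + n) \<le> norm m + norm n" by transfer (rule norm_triangle_ineq)
  show "norm (a *\<^sub>R m) = \<bar>a\<bar> * norm m" by transfer simp
qed (rule sgn_lip_free_def dist_lip_free_def uniformity_lip_free_def open_lip_free_def)+

end

instance lip_free :: ("{metric_space,zero}") banach
proof
  fix X :: "nat \<Rightarrow> 'a lip_free"
  assume X: "Cauchy X"
  have nm: "norm (Rep_lip_free m - Rep_lip_free n) = norm (m - n)" for m n :: "'a lip_free"
    by transfer simp
  have "Cauchy (\<lambda>n. Rep_lip_free (X n))"
    using X unfolding Cauchy_def dist_norm nm .
  then obtain L where L: "(\<lambda>n. Rep_lip_free (X n)) \<longlonglongrightarrow> L"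
    using Cauchy_convergent convergent_def by blast
  have "closed (lip_free_set :: ('a lip0 \<Rightarrow>\<^sub>L real) set)" by (simp add: lip_free_set_def)
  then have "L \<in> lip_free_set"
    by (rule closed_sequentially[OF _ _ L]) (rule Rep_lip_free)
  then obtain m where m: "L = Rep_lip_free m" by (metis Abs_lip_free_inverse)
  have "X \<longlonglongrightarrow> m" using L unfolding m lim_sequentially dist_norm nm .
  then show "convergent X" unfolding convergent_def by blast
qed


section \<open>Slices and denting points\<close>

definition open_halfspace :: "'z::real_normed_vector set \<Rightarrow> bool" where
  "open_halfspace H \<longleftrightarrow> (\<exists>(\<phi> :: 'z \<Rightarrow>\<^sub>L real) a. \<phi> \<noteq> 0 \<and> H = {x. blinfun_apply \<phi> x > a})"

definition slice_of :: "'z::real_normed_vector set \<Rightarrow> 'z set \<Rightarrow> bool" where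
  "slice_of C S \<longleftrightarrow> S \<noteq> {} \<and> (\<exists>H. open_halfspace H \<and> S = C \<inter> H)"

text \<open>Boundedness of \<open>C\<close> makes \<open>diameter\<close> (a real number) the true diameter of each slice.\<close>

definition denting_point :: "'z::real_normed_vector set \<Rightarrow> 'z \<Rightarrow> bool" where
  "denting_point C x \<longleftrightarrow> bounded C \<and> closed C \<and> convex C \<and> x \<in> C \<and>
     (\<forall>\<epsilon>>0. \<exists>S. slice_of C S \<and> x \<in> S \<and> diameter S < \<epsilon>)"


section \<open>The ball-covering index\<close>

definition has_BCP :: "'z::banach itself \<Rightarrow> real \<Rightarrow> bool" where
  "has_BCP _ \<alpha> \<longleftrightarrow> (\<exists>B :: ('z \<times> real) set. countable B \<and>
     sphere 0 1 \<subseteq> (\<Union>(z, r)\<in>B. ball z r) \<and> (\<forall>(z, r)\<in>B. r > 0 \<and> norm z \<ge> r + \<alpha>))"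

definition ball_covering_index :: "'z::banach itself \<Rightarrow> real" where
  "ball_covering_index Z =
     (let A = {\<alpha>\<in>{-1..<1}. has_BCP Z \<alpha>} in if A = {} then -1 else Sup A)"

end

theory Submission imports Defs begin

text \<open>
  A functional \<open>f\<close> of norm 1 almost attains its norm at some denting point \<open>d\<close>. Choose
  \<open>g \<in> Lip\<^sub>0(M)\<close>, identified with the dual of the free space, defining a small slice
  \<open>{m. g(m) > a}\<close> of the unit ball around \<open>d\<close>. For large \<open>t\<close>, the functional \<open>t g - f\<close> is at most
  about \<open>t\<parallel>g\<parallel> - f(d)\<close> on the slice and at most \<open>t a + 1 \<le> t\<parallel>g\<parallel> - 1\<close> off it, so \<open>f\<close> lies in the
  ball of centre \<open>t g\<close> and radius \<open>t\<parallel>g\<parallel> - \<alpha>\<close>. The ball depends only on \<open>d\<close>, and \<open>d\<close> is only needed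
  approximately, so countably many balls suffice by separability of the free space.
\<close>

section \<open>Duality\<close>

lift_definition free_delta :: "'a::{metric_space,zero} \<Rightarrow> 'a lip_free" is lip_eval
  unfolding lip_free_set_def by (meson closure_subset rangeI span_base subsetD)

definition pairing :: "'a::{metric_space,zero} lip_free \<Rightarrow> 'a lip0 \<Rightarrow> real" where
  "pairing m f = blinfun_apply (Rep_lip_free m) f"

lemma norm_Rep_lip_free [simp]: "norm (Rep_lip_free m) = norm m"
  by transfer simp

lemma pairing_bound: "\<bar>pairing m f\<bar> \<le> norm m * norm f"
  using norm_blinfun[of "Rep_lip_free m" f] by (simp add: pairing_def)

lemma bounded_linear_pairing_left: "bounded_linear (\<lambda>m. pairing m f)"
  by (rule bounded_linear_intro[where K = "norm f"])
    (use pairing_bound in \<open>auto simp: pairing_def plus_lip_free.rep_eq scaleR_lip_free.rep_eq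
      blinfun.add_left blinfun.scaleR_left\<close>)

lemma pairing_diff_left: "pairing (m - n) f = pairing m f - pairing n f"
  by (simp add: pairing_def minus_lip_free.rep_eq blinfun.diff_left)

lemma pairing_diff_right: "pairing m (f - g) = pairing m f - pairing m g"
  by (simp add: pairing_def blinfun.diff_right)

lemma pairing_scaleR_left: "pairing (c *\<^sub>R m) f = c * pairing m f"
  by (simp add: pairing_def scaleR_lip_free.rep_eq blinfun.scaleR_left)

lemma pairing_scaleR_right: "pairing m (c *\<^sub>R f) = c * pairing m f"
  by (simp add: pairing_def blinfun.scaleR_right)

lemma pairing_free_delta [simp]: "pairing (free_delta x) f = lip0_apply f x"
  by (simp add: pairing_def free_delta.rep_eq lip_eval.rep_eq)

lemma norm_lip_eval_diff: "norm (lip_eval x - lip_eval y) \<le> dist x y"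
  by (rule norm_blinfun_bound)
    (use lip0_norm_lipschitz in \<open>auto simp: blinfun.diff_left lip_eval.rep_eq mult.commute\<close>)

lemma norm_free_delta_diff: "norm (free_delta x - free_delta y) \<le> dist x y"
  by transfer (rule norm_lip_eval_diff)

lemma free_delta_0 [simp]: "free_delta 0 = 0"
  by transfer (auto intro!: blinfun_eqI simp: lip_eval.rep_eq)

text \<open>The normalized differences (delta(x) - delta(y)) / d(x,y) lie in the unit ball of the
  free space, and pairing with them gives the signed slopes of \<open>f\<close>. A bound without
  absolute values is enough, because swapping x and y changes the sign.\<close>

lemma norm_lip0_le_pairing:
  assumes C: "0 \<le> C" and le: "\<And>m. norm m \<le> 1 \<Longrightarrow> pairing m f \<le> C"
  shows "norm f \<le> C"
proof (rule norm_lip0_le[OF C])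
  have one: "lip0_apply f x - lip0_apply f y \<le> C * dist x y" for x y
  proof (cases "x = y")
    case False
    let ?m = "(1 / dist x y) *\<^sub>R (free_delta x - free_delta y)"
    have "norm ?m \<le> 1"
      using False norm_free_delta_diff[of x y] by (simp add: divide_simps)
    then have "pairing ?m f \<le> C" by (rule le)
    then show ?thesis
      using False by (simp add: pairing_scaleR_left pairing_diff_left divide_simps)
  qed simp
  show "\<bar>lip0_apply f x - lip0_apply f y\<bar> \<le> C * dist x y" for x y
    using one[of x y] one[of y x] by (simp add: dist_commute abs_le_iff)
qed

text \<open>Linearity carries the agreement to the span of the evaluations, continuity to its
  closure, which is the whole free space.\<close>

lemma bounded_linear_lip_free_eqI:
  fixes \<phi> \<psi> :: "'a::{metric_space,zero} lip_free \<Rightarrow> real"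
  assumes \<phi>: "bounded_linear \<phi>" and \<psi>: "bounded_linear \<psi>"
    and eq: "\<And>x. \<phi> (free_delta x) = \<psi> (free_delta x)"
  shows "\<phi> m = \<psi> m"
proof -
  interpret \<phi>: bounded_linear \<phi> by (rule \<phi>)
  interpret \<psi>: bounded_linear \<psi> by (rule \<psi>)
  \<comment> \<open>The span lives in the ambient dual of Lip_0(M), where \<phi> and \<psi> are not
    defined, so the induction also has to produce a preimage \<open>n\<close> in the free
    space.\<close>
  have on_span: "\<exists>n. Rep_lip_free n = u \<and> \<phi> n = \<psi> n" if "u \<in> span (range lip_eval)" for u
    using that
  proof (induction rule: span_induct_alt)
    case base
    show ?case by (intro exI[of _ 0]) (simp add: zero_lip_free.rep_eq \<phi>.zero \<psi>.zero)
  next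
    case (step c x y)
    then obtain z n where "x = lip_eval z" "Rep_lip_free n = y" "\<phi> n = \<psi> n" by auto
    then show ?case
      by (intro exI[of _ "c *\<^sub>R free_delta z + n"])
        (simp add: plus_lip_free.rep_eq scaleR_lip_free.rep_eq free_delta.rep_eq
          \<phi>.add \<psi>.add \<phi>.scaleR \<psi>.scaleR eq)
  qed
  obtain X where X: "\<And>i. X i \<in> span (range lip_eval)" "X \<longlonglongrightarrow> Rep_lip_free m"
    using Rep_lip_free[of m] unfolding lip_free_set_def closure_sequential by blast
  have "\<forall>i. \<exists>n. Rep_lip_free n = X i \<and> \<phi> n = \<psi> n"
    using on_span X(1) by blast
  then obtain Y where Y: "\<And>i. Rep_lip_free (Y i) = X i" "\<And>i. \<phi> (Y i) = \<psi> (Y i)"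
    by metis
  have nm: "norm (Rep_lip_free m - Rep_lip_free n) = norm (m - n)" for m n :: "'a lip_free"
    by transfer simp
  have "Y \<longlonglongrightarrow> m"
    using X(2) unfolding lim_sequentially dist_norm Y(1)[symmetric] nm .
  then have "(\<lambda>i. \<psi> (Y i)) \<longlonglongrightarrow> \<phi> m" "(\<lambda>i. \<psi> (Y i)) \<longlonglongrightarrow> \<psi> m"
    using \<phi>.tendsto[of Y m] \<psi>.tendsto[of Y m] by (simp_all add: Y(2))
  then show ?thesis by (rule LIMSEQ_unique)
qed

text \<open>Surjectivity of Lip_0(M) onto the dual of the free space: composing \<phi> with
  \<open>free_delta\<close> gives a Lipschitz function vanishing at the base point, and its pairing
  agrees with \<phi> on all evaluations.\<close>

lemma lip_free_functional_representation:
  fixes \<phi> :: "'a::{metric_space,zero} lip_free \<Rightarrow>\<^sub>L real"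
  obtains g where "\<And>m. blinfun_apply \<phi> m = pairing m g"
proof
  define h where "h x = blinfun_apply \<phi> (free_delta x)" for x
  have "(norm \<phi>)-lipschitz_on UNIV h"
  proof (rule lipschitz_onI)
    fix x y
    have "dist (h x) (h y) \<le> norm \<phi> * norm (free_delta x - free_delta y)"
      using norm_blinfun[of \<phi> "free_delta x - free_delta y"]
      by (simp add: h_def dist_norm blinfun.diff_right)
    also have "\<dots> \<le> norm \<phi> * dist x y"
      by (intro mult_left_mono norm_free_delta_diff) simp
    finally show "dist (h x) (h y) \<le> norm \<phi> * dist x y" .
  qed simp
  moreover have "h 0 = 0" by (simp add: h_def)
  ultimately have h: "lip0_apply (Abs_lip0 h) = h"
    by (auto intro!: Abs_lip0_inverse)
  show "blinfun_apply \<phi> m = pairing m (Abs_lip0 h)" for m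
    by (rule bounded_linear_lip_free_eqI[OF blinfun.bounded_linear_right bounded_linear_pairing_left])
      (simp add: h, simp add: h_def)
qed

section \<open>Separability\<close>

text \<open>\<open>Q\<close> consists of the rational combinations of elements of \<open>A\<close>.
  Its closure contains every real multiple of an element of \<open>A\<close> and is closed under
  addition, hence contains the span.\<close>

lemma separable_span:
  fixes A :: "'b::real_normed_vector set"
  assumes "countable A"
  obtains Q where "countable Q" "closure (span A) \<subseteq> closure Q"
proof
  define comb where "comb l = (\<Sum>(c, a)\<leftarrow>l. c *\<^sub>R a)" for l :: "(real \<times> 'b) list"
  define Q where "Q = comb ` lists (\<rat> \<times> A)"
  show "countable Q"
    unfolding Q_def using assms countable_rat by (intro countable_image countable_lists countable_SIGMA)
  have addQ: "u + v \<in> Q" if "u \<in> Q" "v \<in> Q" for u v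
  proof -
    obtain k l where "u = comb k" "v = comb l" "k \<in> lists (\<rat> \<times> A)" "l \<in> lists (\<rat> \<times> A)"
      using \<open>u \<in> Q\<close> \<open>v \<in> Q\<close> unfolding Q_def by (elim imageE)
    then have "u + v = comb (k @ l)" "k @ l \<in> lists (\<rat> \<times> A)" by (auto simp: comb_def)
    then show ?thesis unfolding Q_def by blast
  qed
  have zeroQ: "0 \<in> Q"
    unfolding Q_def by (rule image_eqI[of _ _ "[]"]) (auto simp: comb_def)
  have scaleA: "c *\<^sub>R a \<in> closure Q" if "a \<in> A" for c a
  proof -
    have "(\<lambda>c. c *\<^sub>R a) ` closure \<rat> \<subseteq> closure Q"
    proof (rule image_closure_subset)
      show "(\<lambda>c. c *\<^sub>R a) ` \<rat> \<subseteq> closure Q"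
      proof
        fix u assume "u \<in> (\<lambda>c. c *\<^sub>R a) ` \<rat>"
        then obtain c where c: "c \<in> \<rat>" "u = c *\<^sub>R a" by blast
        then have "u = comb [(c, a)]" "[(c, a)] \<in> lists (\<rat> \<times> A)"
          using that by (auto simp: comb_def)
        then have "u \<in> Q" unfolding Q_def by blast
        then show "u \<in> closure Q" using closure_subset by blast
      qed
    qed (auto intro!: continuous_intros)
    then show ?thesis using Rats_closure_real by auto
  qed
  have add: "u + v \<in> closure Q" if "u \<in> closure Q" "v \<in> closure Q" for u v
  proof -
    obtain X Y where "\<And>i. X i \<in> Q" "X \<longlonglongrightarrow> u" "\<And>i. Y i \<in> Q" "Y \<longlonglongrightarrow> v"
      using \<open>u \<in> closure Q\<close> \<open>v \<in> closure Q\<close> unfolding closure_sequential by blast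
    then show ?thesis
      unfolding closure_sequential
      by (intro exI[of _ "\<lambda>i. X i + Y i"]) (auto intro: addQ tendsto_add)
  qed
  have "u \<in> closure Q" if "u \<in> span A" for u
    using that
  proof (induction rule: span_induct_alt)
    case base
    show ?case using zeroQ closure_subset by blast
  qed (auto intro: add scaleA)
  then show "closure (span A) \<subseteq> closure Q"
    by (intro closure_minimal) auto
qed

lemma subspace_closure:
  fixes S :: "'b::real_normed_vector set"
  assumes S: "subspace S"
  shows "subspace (closure S)"
  unfolding subspace_def
proof (intro conjI ballI allI)
  show "0 \<in> closure S" using subspace_0[OF S] closure_subset by blast
next
  fix u v assume "u \<in> closure S" "v \<in> closure S"
  then obtain X Y where "\<And>i. X i \<in> S" "X \<longlonglongrightarrow> u" "\<And>i. Y i \<in> S" "Y \<longlonglongrightarrow> v"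
    unfolding closure_sequential by blast
  then show "u + v \<in> closure S"
    unfolding closure_sequential
    by (intro exI[of _ "\<lambda>i. X i + Y i"]) (auto intro: subspace_add[OF S] tendsto_add)
next
  fix c :: real and u assume "u \<in> closure S"
  then obtain X where "\<And>i. X i \<in> S" "X \<longlonglongrightarrow> u"
    unfolding closure_sequential by blast
  then show "c *\<^sub>R u \<in> closure S"
    unfolding closure_sequential
    by (intro exI[of _ "\<lambda>i. c *\<^sub>R X i"]) (auto intro: subspace_scale[OF S] tendsto_scaleR)
qed

text \<open>Since \<open>lip_eval\<close> is 1-Lipschitz, the evaluations at a countable dense
  subset of M already have dense span. The points of \<open>Q\<close> are not claimed to lie in the
  free space.\<close>

lemma separable_lip_free_set:
  assumes "separable_space (euclidean :: 'a::{metric_space,zero} topology)"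
  obtains Q :: "('a::{metric_space,zero} lip0 \<Rightarrow>\<^sub>L real) set" where "countable Q" "lip_free_set \<subseteq> closure Q"
proof -
  obtain U :: "'a set" where U: "countable U" "closure U = UNIV"
    using assms unfolding separable_space_def by auto
  obtain Q :: "('a lip0 \<Rightarrow>\<^sub>L real) set"
    where Q: "countable Q" "closure (span (lip_eval ` U)) \<subseteq> closure Q"
    using separable_span[OF countable_image[OF U(1)], of lip_eval] by blast
  have "1-lipschitz_on UNIV (lip_eval :: 'a \<Rightarrow> _)"
    by (rule lipschitz_onI) (use norm_lip_eval_diff in \<open>auto simp: dist_norm\<close>)
  then have "continuous_on (closure U) (lip_eval :: 'a \<Rightarrow> _)"
    using continuous_on_subset[OF lipschitz_on_continuous_on] by blast
  then have range: "range lip_eval \<subseteq> closure (span (lip_eval ` U))"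
    using image_closure_subset[of U lip_eval "closure (span (lip_eval ` U))"]
      subset_trans[OF span_superset closure_subset, of "lip_eval ` U"] by (simp add: U(2))
  have "span (range lip_eval) \<subseteq> closure (span (lip_eval ` U))"
    by (rule span_minimal[OF range subspace_closure[OF subspace_span]])
  then have "lip_free_set \<subseteq> closure (span (lip_eval ` U))"
    unfolding lip_free_set_def by (rule closure_minimal) simp
  with Q that show ?thesis by blast
qed

section \<open>Balls from slices\<close>

text \<open>The set where the pairing with \<open>f\<close> is at most \<open>C\<close> is closed
  and convex. If it contained \<open>D\<close>, it would contain the unit ball, forcing
  \<open>norm f\<close> to be at most \<open>C\<close>.\<close>

lemma closed_hull_pairing_gt:
  fixes f :: "'a::{metric_space,zero} lip0"
  assumes hull: "cball (0 :: 'a lip_free) 1 = closure (convex hull D)"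
    and "0 \<le> C" "C < norm f"
  obtains d where "d \<in> D" "pairing d f > C"
proof (rule ccontr)
  assume "\<not> thesis"
  with that have D: "pairing d f \<le> C" if "d \<in> D" for d
    using \<open>d \<in> D\<close> by force
  interpret bounded_linear "\<lambda>m. pairing m f" by (rule bounded_linear_pairing_left)
  have "closed {m. pairing m f \<le> C}"
    by (intro closed_Collect_le continuous_intros linear_continuous_on bounded_linear_axioms)
  moreover have "convex {m. pairing m f \<le> C}"
    using convex_linear_vimage[OF linear_axioms convex_real_interval(2), of C]
    by (simp add: vimage_def)
  ultimately have "closure (convex hull D) \<subseteq> {m. pairing m f \<le> C}"
    by (intro closure_minimal hull_minimal) (use D in auto)
  then have "norm f \<le> C"
    unfolding hull[symmetric] by (intro norm_lip0_le_pairing \<open>0 \<le> C\<close>) auto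
  with \<open>C < norm f\<close> show False by simp
qed

text \<open>Centre and radius are fixed before \<open>f\<close>, so one ball serves all such
  \<open>f\<close>. The slack \<epsilon> pays for the variation of \<open>f\<close> over a slice of
  diameter below \<epsilon>.\<close>

lemma denting_point_ball:
  fixes d :: "'a::{metric_space,zero} lip_free"
  assumes dent: "denting_point (cball 0 1) d" and \<epsilon>: "0 < \<epsilon>" and \<alpha>: "\<alpha> < 1"
  obtains z r where "0 < r" "norm z \<ge> r + \<alpha>"
    "\<And>f. norm f = 1 \<Longrightarrow> pairing d f > \<alpha> + \<epsilon> \<Longrightarrow> f \<in> ball z r"
proof -
  obtain S where S: "slice_of (cball 0 1) S" "d \<in> S" "diameter S < \<epsilon>"
    using dent \<epsilon> unfolding denting_point_def by blast
  then obtain \<phi> :: "'a lip_free \<Rightarrow>\<^sub>L real" and a where "\<phi> \<noteq> 0"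
    and S_\<phi>: "S = cball 0 1 \<inter> {x. blinfun_apply \<phi> x > a}"
    unfolding slice_of_def open_halfspace_def by blast
  obtain g where g: "\<And>m. blinfun_apply \<phi> m = pairing m g"
    using lip_free_functional_representation[of \<phi>] by blast
  have S_eq: "S = {m. norm m \<le> 1 \<and> pairing m g > a}"
    unfolding S_\<phi> g by auto
  define N where "N = norm g"
  have le_N: "pairing m g \<le> N" if "norm m \<le> 1" for m
    using pairing_bound[of m g] mult_right_mono[OF that, of N] by (simp add: N_def)
  have "g \<noteq> 0"
  proof
    assume "g = 0"
    then have "\<phi> = 0" by (intro blinfun_eqI) (simp add: g pairing_def)
    with \<open>\<phi> \<noteq> 0\<close> show False by simp
  qed
  then have N: "N > 0" by (simp add: N_def)
  have aN: "a < N" using S(2) le_N unfolding S_eq by fastforce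
  \<comment> \<open>The summand \<open>2 / (N - a)\<close> makes \<open>t * g\<close> drop by at
    least 2 below \<open>t * N\<close> off the slice; subtracting \<open>f\<close> gives back at
    most 1. The summand \<open>1 / N\<close> ensures \<open>t * N\<close> \<ge> 1 > \<alpha>, so the
    radius is positive.\<close>
  define t where "t = 2 / (N - a) + 1 / N"
  have t: "t > 0" unfolding t_def using aN N by (simp add: add_pos_pos)
  have tN: "t * N \<ge> 1"
    using aN N by (simp add: t_def distrib_right)
  have ta: "t * a + 1 \<le> t * N - 1"
  proof -
    have "t * (N - a) = 2 + (N - a) / N"
      using aN by (simp add: t_def distrib_right del: right_diff_distrib_numeral)
    then have "2 \<le> t * (N - a)" using aN N by simp
    then show ?thesis by (simp add: right_diff_distrib)
  qed
  show ?thesis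
  proof
    show "0 < t * N - \<alpha>" using tN \<alpha> by simp
    show "norm (t *\<^sub>R g) \<ge> t * N - \<alpha> + \<alpha>" using t by (simp add: N_def)
  next
    fix f :: "'a lip0" assume f: "norm f = 1" "pairing d f > \<alpha> + \<epsilon>"
    have abs_f: "\<bar>pairing m f\<bar> \<le> norm m" for m
      using pairing_bound[of m f] f(1) by simp
    \<comment> \<open>Off the slice \<open>t * g - f\<close> stays 1 below \<open>t * N\<close>; on
      it, \<open>pairing d f - diameter S\<close> below. The smaller gap holds on the whole unit
      ball, and both gaps exceed \<alpha>.\<close>
    define C where "C = t * N - min 1 (pairing d f - diameter S)"
    have "norm (t *\<^sub>R g - f) \<le> C"
    proof (rule norm_lip0_le_pairing)
      show "0 \<le> C" using tN by (simp add: C_def min_def)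
      fix m :: "'a lip_free" assume m: "norm m \<le> 1"
      show "pairing m (t *\<^sub>R g - f) \<le> C"
      proof (cases "pairing m g > a")
        case True
        then have "m \<in> S" using m by (simp add: S_eq)
        moreover have "bounded S"
          unfolding S_\<phi> by (rule bounded_subset[OF bounded_cball Int_lower1])
        ultimately have "norm (d - m) \<le> diameter S"
          using diameter_bounded_bound[of S d m] S(2) by (simp add: dist_norm)
        then have "pairing d f - pairing m f \<le> diameter S"
          using abs_f[of "d - m"] by (simp add: pairing_diff_left)
        moreover have "t * pairing m g \<le> t * N"
          using le_N[OF m] t by simp
        ultimately show ?thesis
          by (simp add: C_def pairing_diff_right pairing_scaleR_right min_def)
      next
        case False
        then have "t * pairing m g \<le> t * a" using t by simp
        moreover have "- pairing m f \<le> 1" using abs_f[of m] m by linarith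
        ultimately show ?thesis
          using ta by (simp add: C_def pairing_diff_right pairing_scaleR_right min_def)
      qed
    qed
    also have "C < t * N - \<alpha>"
      using \<alpha> f(2) S(3) by (simp add: C_def min_def)
    finally show "f \<in> ball (t *\<^sub>R g) (t * N - \<alpha>)"
      by (simp add: dist_norm)
  qed
qed

lemma lip0_has_BCP:
  assumes sep: "separable_space (euclidean :: 'a::{metric_space,zero} topology)"
    and hull: "cball (0 :: 'a lip_free) 1 = closure (convex hull {m. denting_point (cball 0 1) m})"
    and \<alpha>: "\<alpha> < 1"
  shows "has_BCP TYPE('a lip0) \<alpha>"
proof -
  \<comment> \<open>For negative \<alpha> the truncation keeps the threshold
    \<open>\<beta> + 3 * \<epsilon>\<close> nonnegative, as \<open>closed_hull_pairing_gt\<close>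
    requires.\<close>
  define \<beta> where "\<beta> = max 0 \<alpha>"
  \<comment> \<open>Some denting point has value above \<open>\<beta> + 3 * \<epsilon>\<close>,
    which is below 1. Passing to a selected denting point near the same \<open>q\<close> costs less
    than \<open>2 * \<epsilon>\<close>; the last \<epsilon> is the slack in
    \<open>denting_point_ball\<close>.\<close>
  define \<epsilon> where "\<epsilon> = (1 - \<beta>) / 4"
  have \<beta>: "0 \<le> \<beta>" "\<alpha> \<le> \<beta>" "\<beta> < 1"
    using \<alpha> by (auto simp: \<beta>_def)
  then have \<epsilon>: "\<epsilon> > 0" and \<epsilon>_\<beta>: "\<beta> + 4 * \<epsilon> = 1"
    by (simp_all add: \<epsilon>_def field_simps)
  obtain Q :: "('a lip0 \<Rightarrow>\<^sub>L real) set" where Q: "countable Q" "lip_free_set \<subseteq> closure Q"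
    using separable_lip_free_set[OF sep] by blast
  \<comment> \<open>Points of \<open>Q\<close> need be neither in the free space nor denting.
    Choosing one denting point within \<epsilon> of each \<open>q\<close> that has any leaves
    countably many, and every denting point is within \<open>2 * \<epsilon>\<close> of a chosen
    one.\<close>
  define near where "near q d \<longleftrightarrow> denting_point (cball 0 1) d \<and> dist (Rep_lip_free d) q < \<epsilon>"
    for q and d :: "'a lip_free"
  define Q' where "Q' = {q \<in> Q. \<exists>d. near q d}"
  obtain D where D: "\<And>q. q \<in> Q' \<Longrightarrow> near q (D q)"
    using bchoice[of Q' near] unfolding Q'_def by blast
  have "\<exists>z r. 0 < r \<and> norm z \<ge> r + \<alpha> \<and>
      (\<forall>f. norm f = 1 \<longrightarrow> pairing (D q) f > \<alpha> + \<epsilon> \<longrightarrow> f \<in> ball z r)" if "q \<in> Q'" for q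
  proof -
    have "denting_point (cball 0 1) (D q)" using D[OF that] by (simp add: near_def)
    then show ?thesis by (rule denting_point_ball[OF _ \<epsilon> \<alpha>]) blast
  qed
  then obtain z r where zr: "\<And>q. q \<in> Q' \<Longrightarrow> 0 < r q \<and> norm (z q) \<ge> r q + \<alpha>"
    and cover: "\<And>q f. q \<in> Q' \<Longrightarrow> norm f = 1 \<Longrightarrow> pairing (D q) f > \<alpha> + \<epsilon> \<Longrightarrow> f \<in> ball (z q) (r q)"
    by metis
  define B where "B = (\<lambda>q. (z q, r q)) ` Q'"
  have "countable B"
    unfolding B_def Q'_def using Q(1) by (intro countable_image countable_Collect)
  moreover have "f \<in> (\<Union>(z, r)\<in>B. ball z r)" if "norm f = 1" for f
  proof -
    obtain d where d: "denting_point (cball 0 1) d" "pairing d f > \<beta> + 3 * \<epsilon>"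
      using closed_hull_pairing_gt[OF hull, of "\<beta> + 3 * \<epsilon>" f] \<open>norm f = 1\<close> \<epsilon> \<beta> \<epsilon>_\<beta> by auto
    have "Rep_lip_free d \<in> closure Q" using Q(2) Rep_lip_free by blast
    then obtain q where q: "q \<in> Q" "dist q (Rep_lip_free d) < \<epsilon>"
      using \<epsilon> closure_approachable by metis
    then have q': "q \<in> Q'" unfolding Q'_def near_def using d(1) by (auto simp: dist_commute)
    have "dist (Rep_lip_free d) (Rep_lip_free (D q)) < 2 * \<epsilon>"
      using q(2) D[OF q'] dist_triangle[of "Rep_lip_free d" "Rep_lip_free (D q)" q]
      by (simp add: near_def dist_commute)
    then have "norm (d - D q) < 2 * \<epsilon>"
      by (metis dist_norm minus_lip_free.rep_eq norm_Rep_lip_free)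
    then have "pairing (D q) f > \<beta> + \<epsilon>"
      using pairing_bound[of "d - D q" f] that d(2) by (simp add: pairing_diff_left)
    then have "f \<in> ball (z q) (r q)"
      using cover[OF q' that] \<beta> by simp
    then show ?thesis using q' unfolding B_def by blast
  qed
  ultimately show ?thesis
    unfolding has_BCP_def using zr by (intro exI[of _ B]) (auto simp: B_def)
qed

theorem proposition5p1:
  assumes "separable_space (euclidean :: 'a::{complete_space,zero} topology)"
    and "cball (0 :: 'a lip_free) 1 = closure (convex hull {m. denting_point (cball 0 1) m})"
  shows "ball_covering_index TYPE('a lip0) = 1"
proof -
  \<comment> \<open>The value 1 itself is excluded from the set; it is reached only as the
    supremum.\<close>
  have "{\<alpha>\<in>{-1..<1}. has_BCP TYPE('a lip0) \<alpha>} = {-1..<1}"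
    using lip0_has_BCP[OF assms] by auto
  then show ?thesis
    unfolding ball_covering_index_def Let_def by simp
qed

end
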